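(* Let $E$ be the figure-eight knot, let $J_N(E;q)$ be its $N$-dimensional colored Jones polynomial, and put $\xi:=\log\bigl((3+\sqrt{5})/2\bigr)$. Then $$J_N\left(E;\exp\left(\frac{\xi}{N}\right)\right)\underset{N\to\infty}{\sim}\frac{\Gamma\left(\frac13\right)}{(3\xi)^{2/3}}\,N^{2/3}.$$
   Context: $A_N\underset{N\to\infty}{\sim}B_N$ means $\lim_{N\to\infty}A_N/B_N=1$; $\Gamma$ is the Gamma function. $J_N(K;q)$ denotes the colored Jones polynomial of a knot $K$ associated with the $N$-dimensional irreducible representation of $sl(2;\mathbb{C})$, normalized so that $J_N(\text{unknot};q)=1$ and $J_2(K;q)$ is the Jones polynomial. For the figure-eight knot $E$ it is given explicitly (Habiro, Le), which may be taken as its definition, by $$J_N(E;q)=\sum_{k=0}^{N-1}\prod_{j=1}^{k}\left(q^{(N+j)/2}-q^{-(N+j)/2}\right)\left(q^{(N-j)/2}-q^{-(N-j)/2}\right),$$ where the empty product ($k=0$) equals $1$ and, for $q=\exp(c/N)$, $q^{s}$ means $\exp(sc/N)$. *)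

theory Defs
  imports "HOL-Analysis.Analysis" "HOL-Library.Landau_Symbols"
begin

text \<open>
  The colored Jones polynomial of the figure-eight knot, by the formula of Habiro and Le. The
  fractional powers of \<^term>\<open>q\<close> are taken with the principal logarithm; the value is independent
  of this choice, since each factor of the product equals \<open>q^N + q^-N - q^j - q^-j\<close>.
\<close>

definition colored_jones_fig8 :: "nat \<Rightarrow> complex \<Rightarrow> complex" where
  "colored_jones_fig8 N q =
     (\<Sum>k<N. \<Prod>j=1..k.
        (q powr ((of_nat N + of_nat j) / 2) - q powr (- ((of_nat N + of_nat j) / 2))) *
        (q powr ((of_nat N - of_nat j) / 2) - q powr (- ((of_nat N - of_nat j) / 2))))"

lemma fig8_factor_branch:
  fixes L :: complex
  shows "(exp ((of_nat N + of_nat j) / 2 * L) - exp (- ((of_nat N + of_nat j) / 2) * L)) *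
         (exp ((of_nat N - of_nat j) / 2 * L) - exp (- ((of_nat N - of_nat j) / 2) * L)) =
         exp L ^ N + inverse (exp L ^ N) - exp L ^ j - inverse (exp L ^ j)"
proof -
  define a where "a = (of_nat N + of_nat j) / 2 * L"
  define b where "b = (of_nat N - of_nat j) / 2 * L"
  have e: "of_nat N * L = a + b" "of_nat j * L = a - b"
    by (simp_all add: a_def b_def field_simps)
  have m: "- ((of_nat N + of_nat j) / 2) * L = - a" "- ((of_nat N - of_nat j) / 2) * L = - b"
    by (simp_all add: a_def b_def)
  have p: "exp L ^ N = exp a * exp b" "exp L ^ j = exp a / exp b"
    using e by (simp_all add: exp_add exp_diff flip: exp_of_nat_mult)
  show ?thesis
    unfolding m p a_def[symmetric] b_def[symmetric] by (simp add: exp_minus field_simps)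
qed

text \<open>At \<open>q = exp (c / N)\<close>, the power \<open>q^s\<close> may be read as \<open>exp (s c / N)\<close>, for every complex \<open>c\<close>.\<close>

lemma colored_jones_fig8_exp:
  "colored_jones_fig8 N (exp (c / of_nat N)) =
     (\<Sum>k<N. \<Prod>j=1..k.
        (exp ((of_nat N + of_nat j) / 2 * (c / of_nat N)) -
         exp (- ((of_nat N + of_nat j) / 2) * (c / of_nat N))) *
        (exp ((of_nat N - of_nat j) / 2 * (c / of_nat N)) -
         exp (- ((of_nat N - of_nat j) / 2) * (c / of_nat N))))"
proof -
  define q where "q = exp (c / of_nat N)"
  have pw: "q powr z = exp (z * Ln q)" for z
    by (simp add: powr_def q_def)
  have "exp (Ln q) = exp (c / of_nat N)"
    by (simp add: q_def)
  then show ?thesis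
    unfolding colored_jones_fig8_def q_def[symmetric] pw fig8_factor_branch
    by (simp add: q_def)
qed

end

(*
  At q = exp (xi / N) we have q^N + q^-N = 3, so the j-th factor is 3 - 2 cosh (j xi / N), which lies
  in [0, 1] and behaves like exp (- (j xi / N)^2) for small j / N. The k-th product is therefore close
  to exp (- xi^2 k^3 / (3 N^2)), and only k of order N^(2/3) contributes. After rescaling by N^(2/3),
  the sum is the integral of a step function, and dominated convergence gives the limit
  integral of exp (- xi^2 t^3 / 3) over t >= 0, which the substitution u = xi^2 t^3 / 3 turns into
  a Gamma integral.
*)
theory Submission
  imports Defs "HOL-Real_Asymp.Real_Asymp"
begin

section \<open>Bounds for \<open>cosh\<close> near 0 and Gaussian bounds for a single factor\<close>

text \<open>Adding the fourth-order Taylor formulas for \<open>exp\<close> at \<open>y\<close> and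
  \<open>- y\<close> cancels the odd terms and leaves a nonnegative remainder. If |y| is at most 1,
  both exponentials in it are at most 3, so its coefficient is at most 6/24.\<close>

lemma two_cosh_bounds:
  fixes y :: real
  shows "2 + y\<^sup>2 \<le> 2 * cosh y" and "\<bar>y\<bar> \<le> 1 \<Longrightarrow> 2 * cosh y \<le> 2 + y\<^sup>2 + y ^ 4 / 4"
proof -
  obtain s where s: "\<bar>s\<bar> \<le> \<bar>y\<bar>" "exp y = (\<Sum>m<4. y ^ m / fact m) + exp s / fact 4 * y ^ 4"
    using Maclaurin_exp_le[of y 4] by blast
  obtain t where t: "\<bar>t\<bar> \<le> \<bar>- y\<bar>"
    "exp (- y) = (\<Sum>m<4. (- y) ^ m / fact m) + exp t / fact 4 * (- y) ^ 4"
    using Maclaurin_exp_le[of "- y" 4] by blast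
  have eq: "2 * cosh y = 2 + y\<^sup>2 + (exp s + exp t) / 24 * y ^ 4"
    unfolding cosh_field_def s(2) t(2)
    by (simp add: eval_nat_numeral fact_numeral field_simps)
  show "2 + y\<^sup>2 \<le> 2 * cosh y"
    unfolding eq by simp
  assume "\<bar>y\<bar> \<le> 1"
  then have "exp s \<le> 3" "exp t \<le> 3"
    using s(1) t(1) by (auto intro!: order_trans[OF _ exp_le])
  then have "(exp s + exp t) / 24 \<le> 1 / 4"
    by simp
  then have "(exp s + exp t) / 24 * y ^ 4 \<le> 1 / 4 * y ^ 4"
    by (rule mult_right_mono) simp
  then show "2 * cosh y \<le> 2 + y\<^sup>2 + y ^ 4 / 4"
    unfolding eq by simp
qed

lemma three_minus_two_cosh_le_exp: "3 - 2 * cosh y \<le> exp (- y\<^sup>2)" for y :: real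
  using two_cosh_bounds(1)[of y] exp_ge_add_one_self[of "- y\<^sup>2"] by simp

text \<open>The factor is \<open>1 - u\<close> with \<open>u\<close> close to y^2, and
  \<open>ln (1 - u)\<close> is at least \<open>- u - 2 * u\<^sup>2\<close> for \<open>u\<close> in
  [0, 1/2]. Hence the Gaussian upper bound is sharp up to a quartic correction in the
  exponent.\<close>

lemma exp_le_three_minus_two_cosh:
  fixes y :: real
  assumes "\<bar>y\<bar> \<le> 1 / 2"
  shows "exp (- y\<^sup>2 - 3 * y ^ 4) \<le> 3 - 2 * cosh y"
proof -
  define u where "u = 2 * cosh y - 2"
  have y2: "y\<^sup>2 \<le> (1 / 2)\<^sup>2"
    using assms by (metis abs_ge_zero power2_abs power_mono)
  have y4: "y ^ 4 = y\<^sup>2 * y\<^sup>2"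
    by (simp add: eval_nat_numeral)
  have y4_le: "y ^ 4 \<le> y\<^sup>2 / 4"
    using mult_left_mono[OF y2, of "y\<^sup>2"] unfolding y4 power_divide by simp
  have "\<bar>y\<bar> \<le> 1"
    using assms by linarith
  then have u: "0 \<le> u" "u \<le> y\<^sup>2 + y ^ 4 / 4"
    using cosh_real_ge_1[of y] two_cosh_bounds(2)[of y] unfolding u_def by linarith+
  \<comment> \<open>As y^2 \<le> 1/4, the term y^4/4 is at most y^2/16, whence 17/16.\<close>
  have u_half: "u \<le> 1 / 2" and u_le: "u \<le> 17 / 16 * y\<^sup>2"
    using u(2) y4_le y2 by (simp_all add: power_divide)
  have "u\<^sup>2 \<le> (17 / 16 * y\<^sup>2)\<^sup>2"
    by (rule power_mono[OF u_le u(1)])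
  also have "\<dots> = 289 / 256 * y ^ 4"
    by (simp add: power_mult_distrib power_divide)
  finally have "u\<^sup>2 \<le> 289 / 256 * y ^ 4" .
  moreover have "0 \<le> y ^ 4"
    by simp
  \<comment> \<open>The quartic terms total 1/4 + 2 * 289/256, which is below 3.\<close>
  ultimately have "- y\<^sup>2 - 3 * y ^ 4 \<le> - u - 2 * u\<^sup>2"
    using u(2) by linarith
  also have "\<dots> \<le> ln (1 - u)"
    using u(1) u_half by (rule ln_one_minus_pos_lower_bound)
  finally have "exp (- y\<^sup>2 - 3 * y ^ 4) \<le> exp (ln (1 - u))"
    by simp
  also have "\<dots> = 1 - u"
    using u_half by (intro exp_ln) simp
  finally show ?thesis
    by (simp add: u_def)
qed

text \<open>Monotonicity of \<open>cosh\<close> on the nonnegative reals; it will make every factor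
  with \<open>j \<le> n\<close> nonnegative once \<open>2 * cosh x \<le> 3\<close>.\<close>

lemma cosh_fraction_le:
  fixes x :: real
  assumes "0 \<le> x" "j \<le> n"
  shows "cosh (real j * (x / real n)) \<le> cosh x"
proof (cases "n = 0")
  case False
  then have "real j * (x / real n) \<le> x"
    using assms mult_right_mono[of "real j" "real n" x] by (simp add: divide_le_eq mult.commute)
  then show ?thesis
    using assms by (subst cosh_real_nonneg_le_iff) simp_all
\<comment> \<open>For \<open>n = 0\<close> the quotient \<open>x / real n\<close> is 0, and the
  claim becomes \<open>1 \<le> cosh x\<close>.\<close>
qed (simp add: cosh_real_ge_1)

section \<open>Power sums and exponential bounds for the products\<close>

text \<open>Comparison with the integral of t^2; this bound and the next one share the leading term
  k^3/3, the source of the cubic exponent.\<close>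

lemma sum_power2_ge: "real k ^ 3 / 3 \<le> (\<Sum>j=1..k. (real j)\<^sup>2)"
  by (induction k) (simp_all add: eval_nat_numeral field_simps)

lemma sum_power2_le: "(\<Sum>j=1..k. (real j)\<^sup>2) \<le> (real k + 1) ^ 3 / 3"
  by (induction k) (simp_all add: eval_nat_numeral field_simps)

text \<open>A crude estimate is enough, since it only enters the error
  \<open>a ^ 4 * real k ^ 5\<close>, of order n^(-2/3) when a is of order 1/n and k of order
  n^(2/3).\<close>

lemma sum_power4_le: "(\<Sum>j=1..k. real j ^ 4) \<le> real k ^ 5"
proof -
  have "(\<Sum>j=1..k. real j ^ 4) \<le> (\<Sum>j=1..k. real k ^ 4)"
    by (intro sum_mono power_mono) auto
  then show ?thesis
    by (simp add: eval_nat_numeral)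
qed

text \<open>The Gaussian bounds may be multiplied because the hypothesis makes all factors
  nonnegative; the exponents then add up to a sum of squares.\<close>

lemma prod_three_minus_two_cosh_le:
  fixes a :: real
  assumes "\<And>j. j \<in> {1..k} \<Longrightarrow> 2 * cosh (real j * a) \<le> 3"
  shows "(\<Prod>j=1..k. 3 - 2 * cosh (real j * a)) \<le> exp (- (a\<^sup>2 * real k ^ 3 / 3))"
proof -
  have "(\<Prod>j=1..k. 3 - 2 * cosh (real j * a)) \<le> (\<Prod>j=1..k. exp (- (real j * a)\<^sup>2))"
    using assms by (intro prod_mono conjI three_minus_two_cosh_le_exp) simp
  also have "\<dots> = exp (- (a\<^sup>2 * (\<Sum>j=1..k. (real j)\<^sup>2)))"
    by (simp add: exp_sum[symmetric] power_mult_distrib sum_distrib_left sum_negf mult.commute)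
  also have "\<dots> \<le> exp (- (a\<^sup>2 * (real k ^ 3 / 3)))"
    using mult_left_mono[OF sum_power2_ge[of k], of "a\<^sup>2"] by simp
  finally show ?thesis
    by simp
qed

text \<open>The bound on \<open>real k * a\<close> puts every argument in the range of the lower
  Gaussian bound; the quartic corrections add up to the second term of the exponent.\<close>

lemma prod_three_minus_two_cosh_ge:
  fixes a :: real
  assumes "0 \<le> a" "real k * a \<le> 1 / 2"
  shows "exp (- (a\<^sup>2 * (real k + 1) ^ 3 / 3) - 3 * a ^ 4 * real k ^ 5)
    \<le> (\<Prod>j=1..k. 3 - 2 * cosh (real j * a))"
proof -
  have small: "\<bar>real j * a\<bar> \<le> 1 / 2" if "j \<in> {1..k}" for j
    using mult_right_mono[of "real j" "real k" a] that assms by simp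
  have "exp (- (a\<^sup>2 * ((real k + 1) ^ 3 / 3)) - 3 * a ^ 4 * real k ^ 5)
    \<le> exp (- (a\<^sup>2 * (\<Sum>j=1..k. (real j)\<^sup>2)) - 3 * a ^ 4 * (\<Sum>j=1..k. real j ^ 4))"
    unfolding exp_le_cancel_iff
    by (intro diff_mono le_imp_neg_le mult_left_mono sum_power2_le sum_power4_le) simp_all
  also have "\<dots> = (\<Prod>j=1..k. exp (- (real j * a)\<^sup>2 - 3 * (real j * a) ^ 4))"
    by (simp add: exp_sum[symmetric] power_mult_distrib sum_distrib_left sum_negf sum_subtractf ac_simps)
  also have "\<dots> \<le> (\<Prod>j=1..k. 3 - 2 * cosh (real j * a))"
    using small by (intro prod_mono conjI exp_le_three_minus_two_cosh) simp_all
  finally show ?thesis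
    by simp
qed

section \<open>Integrals of step functions and of the cubic exponential\<close>

text \<open>Each value \<open>f k\<close> is taken on a cell of length 1/m. Rescaled sums thus
  become integrals over one fixed domain, to which convergence theorems apply.\<close>

lemma has_integral_step_function:
  fixes f :: "nat \<Rightarrow> real"
  assumes "0 < m"
  shows "((\<lambda>t. if nat \<lfloor>t * m\<rfloor> < n then f (nat \<lfloor>t * m\<rfloor>) else 0) has_integral (\<Sum>k<n. f k) / m) {0..}"
proof -
  define I where "I k = {real k / m..<(real k + 1) / m}" for k
  have mem: "t \<in> I k \<longleftrightarrow> nat \<lfloor>t * m\<rfloor> = k" if "0 \<le> t" for t k
  proof -
    have "t \<in> I k \<longleftrightarrow> \<lfloor>t * m\<rfloor> = int k"
      using assms by (simp add: I_def floor_eq_iff field_simps)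
    moreover have "0 \<le> \<lfloor>t * m\<rfloor>"
      using that assms by simp
    ultimately show ?thesis
      by auto
  qed
  have piece: "((\<lambda>t. if t \<in> I k then f k else 0) has_integral f k / m) {0..}" for k
  proof -
    have "((\<lambda>t. f k) has_integral f k / m) {real k / m..(real k + 1) / m}"
      using has_integral_const_real[of "f k" "real k / m" "(real k + 1) / m"] assms
      by (simp add: field_simps)
    \<comment> \<open>The half-open cell differs from the closed interval by its right endpoint
      only.\<close>
    then have "((\<lambda>t. f k) has_integral f k / m) (I k)"
      by (rule has_integral_spike_set_eq[THEN iffD1, rotated 2])
        (auto simp: I_def intro: negligible_subset[OF negligible_sing[of "(real k + 1) / m"]])
    moreover have "I k \<subseteq> {0..}"
      using assms by (auto simp: I_def intro: order_trans[rotated])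
    ultimately show ?thesis
      by simp
  qed
  have "((\<lambda>t. \<Sum>k<n. if t \<in> I k then f k else 0) has_integral (\<Sum>k<n. f k / m)) {0..}"
    by (intro has_integral_sum piece) simp
  \<comment> \<open>At each \<open>t \<ge> 0\<close> at most one summand survives, the one whose
    index is the floor of \<open>t * m\<close>.\<close>
  then show ?thesis
    unfolding sum_divide_distrib
    by (rule has_integral_eq[rotated]) (simp add: mem)
qed

text \<open>Substitute u = c x^3 in the integral of u^(-2/3) exp(-u), which is Gamma(1/3): the
  Jacobian 3 c x^2 cancels the power of x and leaves the constant 3 c^(1/3).\<close>

lemma has_integral_exp_minus_cube:
  fixes c :: real
  assumes "0 < c"
  shows "((\<lambda>t. exp (- (c * t ^ 3))) has_integral Gamma (1 / 3) / (3 * c powr (1 / 3))) {0..}"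
proof -
  define f :: "real \<Rightarrow> real" where "f = (\<lambda>u. u powr (1 / 3 - 1) / exp u)"
  \<comment> \<open>Removing the point 0 does not affect the integral, and on the open half-line the
    laws for \<open>powr\<close> apply.\<close>
  have spike: "(g has_integral i) {0..} \<longleftrightarrow> (g has_integral i) {0<..}" for g :: "real \<Rightarrow> real" and i
    by (intro has_integral_spike_set_eq) (auto intro: negligible_subset[OF negligible_sing[of 0]])
  have "(f has_integral Gamma (1 / 3)) {0..}"
    using Gamma_integral_real[of "1 / 3"] unfolding f_def by simp
  then have f: "(f has_integral Gamma (1 / 3)) {0<..}"
    unfolding spike .
  \<comment> \<open>The change of variables is stated for absolute integrability, which here follows
    from nonnegativity.\<close>
  have abs_f: "f absolutely_integrable_on {0<..}"
    using f by (intro nonnegative_absolutely_integrable_1) (auto simp: f_def)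
  have image: "(\<lambda>x. c * x ^ 3) ` {0<..} = {0<..}"
  proof (intro equalityI subsetI)
    fix u :: real
    assume "u \<in> {0<..}"
    then have "u = c * root 3 (u / c) ^ 3" "root 3 (u / c) \<in> {0<..}"
      using assms by simp_all
    then show "u \<in> (\<lambda>x. c * x ^ 3) ` {0<..}"
      by blast
  qed (use assms in auto)
  have "(\<lambda>x. \<bar>c * (3 * x\<^sup>2)\<bar> * f (c * x ^ 3)) absolutely_integrable_on {0<..} \<and>
      integral {0<..} (\<lambda>x. \<bar>c * (3 * x\<^sup>2)\<bar> * f (c * x ^ 3)) = Gamma (1 / 3)"
  proof (rule has_absolute_integral_change_of_variables_1'[where f = f and g = "\<lambda>x. c * x ^ 3", THEN iffD2])
    show "((\<lambda>x. c * x ^ 3) has_field_derivative c * (3 * x\<^sup>2)) (at x within {0<..})" for x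
      by (auto intro!: derivative_eq_intros)
    show "inj_on (\<lambda>x. c * x ^ 3) {0<..}"
      using assms by (auto simp: inj_on_def power_eq_iff_eq_base)
    show "f absolutely_integrable_on (\<lambda>x. c * x ^ 3) ` {0<..} \<and>
      integral ((\<lambda>x. c * x ^ 3) ` {0<..}) f = Gamma (1 / 3)"
      unfolding image using abs_f f by (simp add: integral_unique)
  qed simp
  then have "((\<lambda>x. \<bar>c * (3 * x\<^sup>2)\<bar> * f (c * x ^ 3)) has_integral Gamma (1 / 3)) {0<..}"
    by (metis absolutely_integrable_on_def has_integral_integral)
  then have "((\<lambda>x. \<bar>c * (3 * x\<^sup>2)\<bar> * f (c * x ^ 3) / (3 * c powr (1 / 3)))
      has_integral Gamma (1 / 3) / (3 * c powr (1 / 3))) {0<..}"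
    by (rule has_integral_divide)
  then have "((\<lambda>x. exp (- (c * x ^ 3))) has_integral Gamma (1 / 3) / (3 * c powr (1 / 3))) {0<..}"
  proof (rule has_integral_eq[rotated])
    fix x :: real
    assume "x \<in> {0<..}"
    then have x: "0 < x"
      by simp
    have "(x ^ 3) powr (1 / 3) = x"
      using x by (simp add: powr_powr flip: powr_numeral)
    then have "(c * x ^ 3) powr (1 / 3) = c powr (1 / 3) * x"
      using x assms by (simp add: powr_mult)
    then have "(c * x ^ 3) powr (1 / 3 - 1) = c powr (1 / 3) * x / (c * x ^ 3)"
      using x assms unfolding powr_diff by simp
    then have "(c * x ^ 3) powr (1 / 3 - 1) = c powr (1 / 3) / (c * x\<^sup>2)"
      using x by (simp add: power3_eq_cube power2_eq_square)
    then show "\<bar>c * (3 * x\<^sup>2)\<bar> * f (c * x ^ 3) / (3 * c powr (1 / 3)) = exp (- (c * x ^ 3))"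
      using x assms by (simp add: f_def exp_minus field_simps)
  qed
  then show ?thesis
    unfolding spike .
qed

section \<open>Pointwise limit of the rescaled products\<close>

text \<open>Rounding down costs less than 1, hence at most \<open>1 / m n\<close> after
  division.\<close>

lemma tendsto_floor_scaled:
  fixes t :: real and m :: "nat \<Rightarrow> real"
  assumes "0 \<le> t" and m: "filterlim m at_top sequentially"
  shows "(\<lambda>n. real (nat \<lfloor>t * m n\<rfloor>) / m n) \<longlonglongrightarrow> t"
proof (rule tendsto_sandwich)
  have pos: "eventually (\<lambda>n. 0 < m n) sequentially"
    using m by (rule filterlim_at_top_dense[THEN iffD1, rule_format])
  show "eventually (\<lambda>n. t - 1 / m n \<le> real (nat \<lfloor>t * m n\<rfloor>) / m n) sequentially"
    using pos
  proof eventually_elim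
    case (elim n)
    have "t * m n - 1 \<le> real (nat \<lfloor>t * m n\<rfloor>)"
      by linarith
    then have "(t * m n - 1) / m n \<le> real (nat \<lfloor>t * m n\<rfloor>) / m n"
      using elim by (intro divide_right_mono) simp_all
    then show ?case
      using elim by (simp add: diff_divide_distrib)
  qed
  show "eventually (\<lambda>n. real (nat \<lfloor>t * m n\<rfloor>) / m n \<le> t) sequentially"
    using pos
  proof eventually_elim
    case (elim n)
    then have "real (nat \<lfloor>t * m n\<rfloor>) \<le> t * m n"
      using assms(1) by simp
    then show ?case
      using elim by (simp add: field_simps)
  qed
  have "(\<lambda>n. 1 / m n) \<longlonglongrightarrow> 0"
    using m by (intro tendsto_divide_0[OF tendsto_const] filterlim_at_top_imp_at_infinity)
  then show "(\<lambda>n. t - 1 / m n) \<longlonglongrightarrow> t"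
    using tendsto_diff[OF tendsto_const[of t]] by fastforce
qed simp

text \<open>Squeezes the product between the two exponential bounds with a = x/n. For k of order
  n^(2/3), a^2 k^3 has a finite limit while a^4 k^5 tends to 0. The second claim makes the cutoff at
  \<open>n\<close> harmless in the limit.\<close>

lemma tendsto_prod_three_minus_two_cosh:
  fixes x s :: real and k :: "nat \<Rightarrow> nat"
  assumes x: "0 < x" "2 * cosh x \<le> 3"
    and k: "(\<lambda>n. real (k n) / real n powr (2 / 3)) \<longlonglongrightarrow> s"
  shows "(\<lambda>n. \<Prod>j=1..k n. 3 - 2 * cosh (real j * (x / real n))) \<longlonglongrightarrow> exp (- (x\<^sup>2 / 3 * s ^ 3))"
    and "eventually (\<lambda>n. k n < n) sequentially"
proof -
  \<comment> \<open>With r = n^(1/3), both n and n^(2/3) are integer powers of r, so the exponents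
    can be compared by algebra.\<close>
  define r where "r n = real n powr (1 / 3)" for n :: nat
  have r_pos: "eventually (\<lambda>n. 0 < r n) sequentially"
    using eventually_gt_at_top[of 0] by eventually_elim (simp add: r_def)
  have r3: "real n = r n ^ 3" for n
    by (cases "n = 0") (simp_all add: r_def powr_power)
  have r2: "real n powr (2 / 3) = (r n)\<^sup>2" for n
    by (cases "n = 0") (simp_all add: r_def powr_power)
  define q where "q n = real (k n) / (r n)\<^sup>2" for n
  have q: "q \<longlonglongrightarrow> s"
    using k unfolding r2 q_def .
  have inv_r: "(\<lambda>n. 1 / r n) \<longlonglongrightarrow> 0"
    unfolding r_def by real_asymp
  have lim0: "(\<lambda>n. q n * (1 / r n)) \<longlonglongrightarrow> s * 0"
    by (intro tendsto_intros q inv_r)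
  \<comment> \<open>Here q/r equals k/n: the bound 1 yields k < n, and 1/(2x) yields k x/n \<le>
    1/2.\<close>
  have "eventually (\<lambda>n. q n * (1 / r n) < min 1 (1 / (2 * x))) sequentially"
    using x lim0 by (intro order_tendstoD(2)) auto
  with r_pos have small: "eventually (\<lambda>n. k n < n \<and> real (k n) * (x / real n) \<le> 1 / 2) sequentially"
  proof eventually_elim
    case (elim n)
    have "q n * (1 / r n) = real (k n) / real n"
      unfolding q_def r3[of n] by (simp add: eval_nat_numeral)
    then have "real (k n) / real n < 1" "real (k n) / real n < 1 / (2 * x)"
      using elim by simp_all
    moreover have "0 < real n"
      using elim by (simp add: r3)
    ultimately show ?case
      using x by (simp add: field_simps)
  qed
  then show "eventually (\<lambda>n. k n < n) sequentially"
    by eventually_elim simp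
  \<comment> \<open>In the scaled variable q = k/r^2, the shift from k to k + 1 adds 1/r^2, and the
    quartic error gains the factor 1/r^2.\<close>
  have lower: "(\<lambda>n. exp (- (x\<^sup>2 * (q n + (1 / r n)\<^sup>2) ^ 3 / 3) - 3 * x ^ 4 * q n ^ 5 * (1 / r n)\<^sup>2))
      \<longlonglongrightarrow> exp (- (x\<^sup>2 * (s + 0\<^sup>2) ^ 3 / 3) - 3 * x ^ 4 * s ^ 5 * 0\<^sup>2)"
    by (intro tendsto_intros q inv_r) simp_all
  have upper: "(\<lambda>n. exp (- (x\<^sup>2 * q n ^ 3 / 3))) \<longlonglongrightarrow> exp (- (x\<^sup>2 * s ^ 3 / 3))"
    by (intro tendsto_intros q) simp_all
  show "(\<lambda>n. \<Prod>j=1..k n. 3 - 2 * cosh (real j * (x / real n))) \<longlonglongrightarrow> exp (- (x\<^sup>2 / 3 * s ^ 3))"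
  proof (rule tendsto_sandwich)
    show "eventually (\<lambda>n. exp (- (x\<^sup>2 * (q n + (1 / r n)\<^sup>2) ^ 3 / 3) - 3 * x ^ 4 * q n ^ 5 * (1 / r n)\<^sup>2)
        \<le> (\<Prod>j=1..k n. 3 - 2 * cosh (real j * (x / real n)))) sequentially"
      using small r_pos
    proof eventually_elim
      case (elim n)
      have "x\<^sup>2 * (q n + (1 / r n)\<^sup>2) ^ 3 / 3 = (x / real n)\<^sup>2 * (real (k n) + 1) ^ 3 / 3"
        using elim unfolding q_def r3[of n] by (simp add: field_simps flip: power_mult)
      moreover have "3 * x ^ 4 * q n ^ 5 * (1 / r n)\<^sup>2 = 3 * (x / real n) ^ 4 * real (k n) ^ 5"
        using elim unfolding q_def r3[of n] by (simp add: power_divide flip: power_mult power_add)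
      ultimately show ?case
        using prod_three_minus_two_cosh_ge[of "x / real n" "k n"] elim x by (simp only:) simp
    qed
    show "eventually (\<lambda>n. (\<Prod>j=1..k n. 3 - 2 * cosh (real j * (x / real n)))
        \<le> exp (- (x\<^sup>2 * q n ^ 3 / 3))) sequentially"
      using small r_pos
    proof eventually_elim
      case (elim n)
      have "2 * cosh (real j * (x / real n)) \<le> 3" if "j \<in> {1..k n}" for j
        using cosh_fraction_le[of x j n] that elim x by simp
      moreover have "x\<^sup>2 * q n ^ 3 / 3 = (x / real n)\<^sup>2 * real (k n) ^ 3 / 3"
        unfolding q_def r3[of n] by (simp add: power_divide flip: power_mult)
      ultimately show ?case
        using prod_three_minus_two_cosh_le[of "k n" "x / real n"] by simp
    qed
  qed (use lower upper in simp_all)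
qed

section \<open>Dominated convergence for the rescaled sum\<close>

lemma sum_prod_three_minus_two_cosh_tendsto:
  fixes x :: real
  assumes x: "0 < x" "2 * cosh x \<le> 3"
  shows "(\<lambda>n. (\<Sum>k<n. \<Prod>j=1..k. 3 - 2 * cosh (real j * (x / real n))) / real n powr (2 / 3))
    \<longlonglongrightarrow> Gamma (1 / 3) / (3 * x) powr (2 / 3)"
proof -
  define c where "c = x\<^sup>2 / 3"
  have c: "0 < c"
    using x by (simp add: c_def)
  define P where "P n k = (\<Prod>j=1..k. 3 - 2 * cosh (real j * (x / real n)))" for n k
  define m where "m n = real n powr (2 / 3)" for n :: nat
  define F where "F = (\<lambda>n t. if nat \<lfloor>t * m n\<rfloor> < n then P n (nat \<lfloor>t * m n\<rfloor>) else 0)"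
  have m_lim: "filterlim m at_top sequentially"
    unfolding m_def by real_asymp
  have F_int: "(F n has_integral (\<Sum>k<n. P n k) / m n) {0..}" for n
  \<comment> \<open>At \<open>n = 0\<close> the scale \<open>m n\<close> is 0, but the step function
    and the sum both vanish.\<close>
  proof (cases "n = 0")
    case True
    then show ?thesis
      by (simp add: F_def)
  next
    case False
    then show ?thesis
      unfolding F_def by (intro has_integral_step_function) (simp add: m_def)
  qed
  have F_bound: "norm (F n t) \<le> exp (5 * c) * exp (- (3 * c * t))" if "t \<in> {0..}" for n t
  proof (cases "nat \<lfloor>t * m n\<rfloor> < n")
    case True
    define k where "k = nat \<lfloor>t * m n\<rfloor>"
    have n: "1 \<le> n" and kn: "k < n"
      using True by (auto simp: k_def)
    have m: "1 \<le> m n"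
      using n by (simp add: m_def ge_one_powr_ge_zero)
    \<comment> \<open>This identity turns the exponent (x/n)^2 k^3/3 into c s^3 for s = k/m.\<close>
    have m3: "m n ^ 3 = (real n)\<^sup>2"
      using n by (simp add: m_def powr_power)
    have le: "2 * cosh (real j * (x / real n)) \<le> 3" if "j \<in> {1..k}" for j
      using cosh_fraction_le[of x j n] that kn x by simp
    have "0 \<le> P n k"
      unfolding P_def using le by (intro prod_nonneg) simp
    define s where "s = real k / m n"
    have "t * m n - 1 \<le> real k"
      unfolding k_def by linarith
    then have "(t * m n - 1) / m n \<le> s"
      using m unfolding s_def by (intro divide_right_mono) simp_all
    then have "t - 1 / m n \<le> s"
      using m by (simp add: diff_divide_distrib)
    \<comment> \<open>Since \<open>m n\<close> is at least 1, rounding costs at most 1 uniformly in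
      \<open>n\<close>.\<close>
    then have t: "t - 1 \<le> s"
      using m by (smt (verit) divide_le_eq_1)
    have s: "0 \<le> s"
      using m by (simp add: s_def)
    \<comment> \<open>The tangent of \<open>s ^ 3\<close> at 1 trades the cubic exponent for a linear one, giving an integrable
      majorant independent of \<open>n\<close>.\<close>
    have "s ^ 3 - (3 * s - 2) = (s - 1)\<^sup>2 * (s + 2)"
      by (simp add: eval_nat_numeral algebra_simps)
    then have "3 * s - 2 \<le> s ^ 3"
      using s by (smt (verit) mult_nonneg_nonneg zero_le_power2)
    \<comment> \<open>3(t - 1) - 2 = 3t - 5, the origin of \<open>5 * c\<close> in the
      majorant.\<close>
    then have "3 * t - 5 \<le> s ^ 3"
      using t by simp
    then have "c * (3 * t - 5) \<le> c * s ^ 3"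
      using c by (intro mult_left_mono) simp_all
    moreover have "P n k \<le> exp (- (c * s ^ 3))"
      using prod_three_minus_two_cosh_le[of k "x / real n", OF le] m3
      by (simp add: P_def c_def s_def power_divide mult.commute)
    ultimately have "P n k \<le> exp (5 * c + - (3 * c * t))"
      by (elim order_trans) (simp add: algebra_simps)
    then show ?thesis
      using True \<open>0 \<le> P n k\<close> unfolding exp_add by (simp add: F_def k_def)
  qed (simp add: F_def)
  have F_lim: "(\<lambda>n. F n t) \<longlonglongrightarrow> exp (- (c * t ^ 3))" if "t \<in> {0..}" for t
  proof -
    have k: "(\<lambda>n. real (nat \<lfloor>t * m n\<rfloor>) / real n powr (2 / 3)) \<longlonglongrightarrow> t"
      using tendsto_floor_scaled[OF _ m_lim, of t] that by (simp add: m_def)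
    show ?thesis
    proof (rule Lim_transform_eventually)
      show "(\<lambda>n. P n (nat \<lfloor>t * m n\<rfloor>)) \<longlonglongrightarrow> exp (- (c * t ^ 3))"
        using tendsto_prod_three_minus_two_cosh(1)[OF x k] unfolding P_def c_def .
      show "eventually (\<lambda>n. P n (nat \<lfloor>t * m n\<rfloor>) = F n t) sequentially"
        using tendsto_prod_three_minus_two_cosh(2)[OF x k] by eventually_elim (simp add: F_def)
    qed
  qed
  have "(\<lambda>t. exp (5 * c) * exp (- (3 * c * t))) integrable_on {0..}"
    using has_integral_exp_minus_to_infinity[of "3 * c" 0] c
    by (intro integrable_on_mult_right) (auto simp: integrable_on_def)
  then have "(\<lambda>n. integral {0..} (F n)) \<longlonglongrightarrow> integral {0..} (\<lambda>t. exp (- (c * t ^ 3)))"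
    using F_int F_bound F_lim by (intro dominated_convergence(2)) (auto simp: integrable_on_def)
  then have lim: "(\<lambda>n. (\<Sum>k<n. P n k) / m n) \<longlonglongrightarrow> Gamma (1 / 3) / (3 * c powr (1 / 3))"
    unfolding integral_unique[OF F_int] integral_unique[OF has_integral_exp_minus_cube[OF c]] .
  \<comment> \<open>Both sides are the cube root of 27 c = 9 x^2.\<close>
  have "3 * c powr (1 / 3) = (3 * x) powr (2 / 3)"
  proof -
    have "(3 * x) powr (2 / 3) = ((3 * x) powr 2) powr (1 / 3)"
      unfolding powr_powr by simp
    also have "(3 * x) powr 2 = (3 * x)\<^sup>2"
      using x by (simp only: powr_numeral)
    also have "(3 * x)\<^sup>2 = 3 ^ 3 * c"
      by (simp add: c_def power2_eq_square)
    also have "\<dots> powr (1 / 3) = ((3 :: real) ^ 3) powr (1 / 3) * c powr (1 / 3)"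
      using c by (simp add: powr_mult)
    also have "((3 :: real) ^ 3) powr (1 / 3) = 3"
      by (simp add: powr_powr flip: powr_numeral)
    finally show ?thesis ..
  qed
  with lim show ?thesis
    by (simp add: P_def m_def)
qed

section \<open>Return to the colored Jones polynomial\<close>

text \<open>Each factor is q^N + q^-N - q^j - q^-j, and for q = exp(x/N) each pair of inverse powers
  is twice a real \<open>cosh\<close>.\<close>

lemma colored_jones_fig8_cosh:
  fixes x :: real
  shows "colored_jones_fig8 N (exp (of_real x / of_nat N)) =
    of_real (\<Sum>k<N. \<Prod>j=1..k. 2 * cosh x - 2 * cosh (real j * (x / real N)))"
proof (cases "N = 0")
  case False
  define L :: complex where "L = of_real (x / real N)"
  have L: "of_real x / of_nat N = L"
    by (simp add: L_def)
  have N: "exp L ^ N + inverse (exp L ^ N) = of_real (2 * cosh x)"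
    using False
    by (simp add: L_def cosh_field_def exp_minus flip: exp_of_real exp_of_nat_mult)
  have j: "exp L ^ j + inverse (exp L ^ j) = of_real (2 * cosh (real j * (x / real N)))" for j
    by (simp add: L_def cosh_field_def exp_minus flip: exp_of_real exp_of_nat_mult)
  have "exp L ^ N + inverse (exp L ^ N) - exp L ^ j - inverse (exp L ^ j) =
      of_real (2 * cosh x - 2 * cosh (real j * (x / real N)))" for j
    unfolding of_real_diff N[symmetric] j[symmetric] by simp
  then show ?thesis
    unfolding colored_jones_fig8_exp
    unfolding L fig8_factor_branch by (simp only: of_real_sum of_real_prod)
qed (simp add: colored_jones_fig8_def)

theorem theorem1p1:
  fixes \<xi> :: real
  defines "\<xi> \<equiv> ln ((3 + sqrt 5) / 2)"
  shows "(\<lambda>N::nat. colored_jones_fig8 N (exp (of_real \<xi> / of_nat N)))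
           \<sim>[sequentially]
         (\<lambda>N::nat. of_real (Gamma (1 / 3) / (3 * \<xi>) powr (2 / 3) * real N powr (2 / 3)))"
proof -
  have pos: "0 < \<xi>"
    unfolding \<xi>_def by (intro ln_gt_zero) (simp add: add_pos_pos)
  \<comment> \<open>The conjugates have product 1 and sum 3, so \<open>2 * cosh \<xi>\<close> is
    exactly 3, the boundary case of the bound assumed for the sum.\<close>
  have "inverse ((3 + sqrt 5) / 2) = (3 - sqrt 5) / 2"
    by (rule inverse_unique) (simp add: algebra_simps)
  then have cosh: "2 * cosh \<xi> = 3"
    unfolding \<xi>_def by (subst cosh_ln_real) (simp_all add: add_pos_pos field_simps)
  define S where "S N = (\<Sum>k<N. \<Prod>j=1..k. 3 - 2 * cosh (real j * (\<xi> / real N)))" for N :: nat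
  define C where "C = Gamma (1 / 3) / (3 * \<xi>) powr (2 / 3)"
  \<comment> \<open>A nonzero limit is what turns convergence of the quotient into asymptotic
    equivalence.\<close>
  have C: "C \<noteq> 0"
    using pos Gamma_real_pos[of "1 / 3"] by (simp add: C_def less_imp_neq[symmetric])
  have "(\<lambda>N. S N / real N powr (2 / 3)) \<longlonglongrightarrow> C"
    using sum_prod_three_minus_two_cosh_tendsto[OF pos] cosh by (simp add: S_def C_def)
  then have "(\<lambda>N. complex_of_real (S N / real N powr (2 / 3))) \<longlonglongrightarrow> complex_of_real C"
    by (rule tendsto_of_real)
  then have "(\<lambda>N. complex_of_real (S N)) \<sim>[sequentially]
      (\<lambda>N. complex_of_real C * complex_of_real (real N powr (2 / 3)))"
    using C by (intro asymp_equivI'_const) simp_all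
  then have "(\<lambda>N. complex_of_real (S N)) \<sim>[sequentially] (\<lambda>N. of_real (C * real N powr (2 / 3)))"
    by simp
  then show ?thesis
    unfolding colored_jones_fig8_cosh cosh S_def C_def .
qed

end
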